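(* Let $\mathfrak G$ be a loop-graph with $n$ vertices, $n-1$ non-loop edges and exactly one loop. Then $\mathfrak G$ has a $\rho$-labeling if and only if its cyclic blowup matrix $H_{\mathfrak G}$ is $\mathfrak U_n$-apportionable, i.e., there is $Q\in\mathfrak U_n$ such that $QH_{\mathfrak G}Q^*$ is uniform. In this case, the $\mathcal U$-apportionment constant of $H_{\mathfrak G}$ is $\kappa=(2n-1)^{-1}$.
   Context: A complex square matrix is uniform if all its entries have the same absolute value. If $UAU^*$ is uniform for some unitary $U$, the (unique) $\mathcal U$-apportionment constant of $A$ is the common absolute value of the entries of $UAU^*$. A loop-graph is a finite undirected graph in which loops are allowed but multiple edges are not. The vertices of a loop-graph with $n$ vertices are labelled $0,\dots,n-1$; $A_{\mathfrak G}$ is the $n\times n$ 0-1 adjacency matrix (a loop at $i$ gives entry $1$ in position $(i,i)$). If $\mathfrak G$ has $m$ edges in total (counting loops), a $\rho$-labeling of $\mathfrak G$ is an injective function $f:V(\mathfrak G)\to\{0,\dots,2m-2\}$ such that $\big\{\min\{|f(u)-f(v)|,\,2m-1-|f(u)-f(v)|\}:\{u,v\}\in E(\mathfrak G)\big\}=\{0,\dots,m-1\}$ (where a loop at $u$ contributes $u=v$). Here $m=n$. Matrix indices start at $0$. $C_{2n-1}$ is the $(2n-1)\times(2n-1)$ cyclic permutation matrix with $C_{2n-1}\mathbf e_i=\mathbf e_{i+1 \bmod (2n-1)}$. Let $\omega$ be a primitive $(2n-1)$-th root of unity and $\mathbf w=[1,\omega,\omega^2,\dots,\omega^{2n-2}]^\top$.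 $U_n\in\mathbb{C}^{(2n-1)^2\times(2n-1)^2}$ is the $(2n-1)\times(2n-1)$ block matrix whose $(i,j)$-block is the $(2n-1)\times(2n-1)$ matrix $\frac{1}{\sqrt{2n-1}}C_{2n-1}^{\,j}\operatorname{diag}(\mathbf w)^i$ for $0\le i,j<2n-1$; $U_n$ is unitary. Define $\mathfrak U_n=\{U_n(I_{2n-1}\otimes P)U_n^*: P \text{ a } (2n-1)\times(2n-1)\text{ permutation matrix}\}$, a group of unitary matrices, and the cyclic blowup matrix $H_{\mathfrak G}=U_n\big(I_{2n-1}\otimes(A_{\mathfrak G}\oplus O_{n-1})\big)U_n^*$, where $O_{n-1}$ is the $(n-1)\times(n-1)$ zero matrix and $\otimes$ is the Kronecker product. *)

theory Defs
  imports
    "Jordan_Normal_Form.Schur_Decomposition"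
    "HOL-Combinatorics.Permutations"
begin

section \<open>Unitary, uniform and apportionable matrices\<close>

definition unitary_mats :: "nat \<Rightarrow> complex mat set" where
  "unitary_mats d = {U \<in> carrier_mat d d.
     U * mat_adjoint U = 1\<^sub>m d \<and> mat_adjoint U * U = 1\<^sub>m d}"

definition uniform_mat_with :: "real \<Rightarrow> complex mat \<Rightarrow> bool" where
  "uniform_mat_with c A \<longleftrightarrow> square_mat A \<and>
     (\<forall>i<dim_row A. \<forall>j<dim_col A. cmod (A $$ (i, j)) = c)"

definition uniform_mat :: "complex mat \<Rightarrow> bool" where
  "uniform_mat A \<longleftrightarrow> (\<exists>c. uniform_mat_with c A)"

definition apportionable :: "complex mat set \<Rightarrow> complex mat \<Rightarrow> bool" where
  "apportionable \<G> A \<longleftrightarrow> (\<exists>Q\<in>\<G>. uniform_mat (Q * A * mat_adjoint Q))"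

text \<open>
  The constant is unique for nonempty \<open>A\<close>, because unitary conjugation preserves the Frobenius
  norm. It is meaningful only if \<open>A\<close> is apportionable by some unitary matrix.
\<close>

definition U_apportionment_constant :: "complex mat \<Rightarrow> real" where
  "U_apportionment_constant A =
     (THE \<kappa>. \<exists>U\<in>unitary_mats (dim_row A). uniform_mat_with \<kappa> (U * A * mat_adjoint U))"


section \<open>Loop-graphs and \<open>\<rho>\<close>-labelings\<close>

text \<open>
  A loop-graph on the vertices \<open>0, \<dots>, n - 1\<close> is given by its edge set; the edge \<open>{u, v}\<close> is a
  loop if \<open>u = v\<close>, so that loops are the edges of cardinality 1.
\<close>

definition loop_graph :: "nat \<Rightarrow> nat set set \<Rightarrow> bool" where
  "loop_graph n E \<longleftrightarrow> (\<forall>e\<in>E. \<exists>u<n. \<exists>v<n. e = {u, v})"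

definition loops :: "nat set set \<Rightarrow> nat set set" where
  "loops E = {e \<in> E. card e = 1}"

definition nonloop_edges :: "nat set set \<Rightarrow> nat set set" where
  "nonloop_edges E = {e \<in> E. card e = 2}"

definition adjacency_mat :: "nat \<Rightarrow> nat set set \<Rightarrow> complex mat" where
  "adjacency_mat n E = mat n n (\<lambda>(i, j). if {i, j} \<in> E then 1 else 0)"

text \<open>Labels are integers, so that neither \<open>2 m - 2\<close> nor the differences are truncated.\<close>

definition rho_labeling :: "nat \<Rightarrow> nat set set \<Rightarrow> (nat \<Rightarrow> int) \<Rightarrow> bool" where
  "rho_labeling n E f \<longleftrightarrow>
     (let m = int (card E) in
        inj_on f {..<n} \<and> f ` {..<n} \<subseteq> {0..2 * m - 2} \<and>
        {min \<bar>f u - f v\<bar> (2 * m - 1 - \<bar>f u - f v\<bar>) | u v. {u, v} \<in> E} = {0..m - 1})"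


section \<open>Cyclic blowups\<close>

definition kronecker_product :: "complex mat \<Rightarrow> complex mat \<Rightarrow> complex mat" (infixl \<open>\<otimes>\<^sub>m\<close> 70) where
  "A \<otimes>\<^sub>m B = mat (dim_row A * dim_row B) (dim_col A * dim_col B)
     (\<lambda>(i, j). A $$ (i div dim_row B, j div dim_col B) * B $$ (i mod dim_row B, j mod dim_col B))"

definition block_mat :: "nat \<Rightarrow> nat \<Rightarrow> (nat \<Rightarrow> nat \<Rightarrow> complex mat) \<Rightarrow> complex mat" where
  \<comment> \<open>the \<open>k\<close> by \<open>k\<close> block matrix whose \<open>(i, j)\<close>-block is the \<open>d\<close> by \<open>d\<close> matrix \<open>B i j\<close>\<close>
  "block_mat k d B = mat (k * d) (k * d)
     (\<lambda>(r, s). B (r div d) (s div d) $$ (r mod d, s mod d))"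

definition perm_mat :: "nat \<Rightarrow> (nat \<Rightarrow> nat) \<Rightarrow> complex mat" where
  \<comment> \<open>maps the unit vector \<open>e\<^sub>j\<close> to \<open>e\<^bsub>p j\<^esub>\<close>\<close>
  "perm_mat d p = mat d d (\<lambda>(i, j). if i = p j then 1 else 0)"

definition permutation_mats :: "nat \<Rightarrow> complex mat set" where
  "permutation_mats d = {perm_mat d p | p. p permutes {..<d}}"

definition cyclic_mat :: "nat \<Rightarrow> complex mat" where
  "cyclic_mat d = perm_mat d (\<lambda>i. (i + 1) mod d)"

definition primitive_root_of_unity :: "nat \<Rightarrow> complex \<Rightarrow> bool" where
  "primitive_root_of_unity d \<omega> \<longleftrightarrow> \<omega> ^ d = 1 \<and> (\<forall>k. 0 < k \<and> k < d \<longrightarrow> \<omega> ^ k \<noteq> 1)"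

definition blowup_unitary :: "complex \<Rightarrow> nat \<Rightarrow> complex mat" where
  "blowup_unitary \<omega> n =
     (let d = 2 * n - 1 in
        block_mat d d (\<lambda>i j. complex_of_real (1 / sqrt (real d)) \<cdot>\<^sub>m
          (cyclic_mat d ^\<^sub>m j * mat_diag d (\<lambda>k. \<omega> ^ k) ^\<^sub>m i)))"

definition blowup_group :: "complex \<Rightarrow> nat \<Rightarrow> complex mat set" where
  "blowup_group \<omega> n =
     {blowup_unitary \<omega> n * (1\<^sub>m (2 * n - 1) \<otimes>\<^sub>m P) * mat_adjoint (blowup_unitary \<omega> n) | P.
        P \<in> permutation_mats (2 * n - 1)}"

definition cyclic_blowup_mat :: "complex \<Rightarrow> nat \<Rightarrow> nat set set \<Rightarrow> complex mat" where
  "cyclic_blowup_mat \<omega> n E =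
     blowup_unitary \<omega> n
       * (1\<^sub>m (2 * n - 1) \<otimes>\<^sub>m diag_block_mat [adjacency_mat n E, 0\<^sub>m (n - 1) (n - 1)])
       * mat_adjoint (blowup_unitary \<omega> n)"

end

theory Submission
  imports Defs "HOL-Number_Theory.Cong"
begin

text \<open>
  Put \<open>d = 2 n - 1\<close> and let \<open>P\<close> be the matrix of a permutation \<open>p\<close>. Conjugating the blowup matrix
  by the element of the group given by \<open>P\<close> yields a matrix whose entry at row \<open>i d + r\<close> and column
  \<open>k d + s\<close> is \<open>1 / d\<close> times the sum of \<open>\<omega>\<^bsup>i p(a) - k p(b)\<^esup>\<close> over the ordered edges \<open>(a, b)\<close> with
  \<open>p(a) - p(b) \<equiv> r - s\<close> modulo \<open>d\<close>. For \<open>i = k = 0\<close> the sum counts these ordered edges, so uniformity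
  makes every residue a difference. There are exactly \<open>d\<close> ordered edges, so conversely, if
  every residue is a difference, then each sum has a single term, of modulus 1. Up to sign, the
  residues modulo \<open>d\<close> are the numbers \<open>0, \<dots>, n - 1\<close>, and a labeling is the restriction of a
  permutation of \<open>0, \<dots>, d - 1\<close>; hence the condition says that \<open>p\<close> is a \<open>\<rho>\<close>-labeling.
  The apportionment constant is determined by the Frobenius norm.
\<close>


section \<open>Unitary conjugation and the Frobenius norm\<close>

lemma mat_adjoint_carrier [simp]:
  "A \<in> carrier_mat m n \<Longrightarrow> mat_adjoint A \<in> carrier_mat n m"
  by (auto simp: mat_adjoint_def)

lemma dim_mat_adjoint [simp]:
  "dim_row (mat_adjoint A) = dim_col A" "dim_col (mat_adjoint A) = dim_row A"
  by (auto simp: mat_adjoint_def)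

lemma index_mat_adjoint [simp]:
  fixes A :: "complex mat"
  assumes "i < dim_col A" "j < dim_row A"
  shows "mat_adjoint A $$ (i, j) = cnj (A $$ (j, i))"
  using assms by (auto simp: mat_adjoint_def mat_of_rows_index)

lemma mat_adjoint_mult:
  fixes A B :: "complex mat"
  assumes "A \<in> carrier_mat m k" "B \<in> carrier_mat k n"
  shows "mat_adjoint (A * B) = mat_adjoint B * mat_adjoint A"
  using assms by (intro eq_matI) (auto simp: scalar_prod_def mult.commute)

lemma mat_adjoint_adjoint [simp]:
  fixes A :: "complex mat"
  shows "mat_adjoint (mat_adjoint A) = A"
  by (intro eq_matI) auto

lemma index_mult_mat_sum:
  assumes "A \<in> carrier_mat m k" "B \<in> carrier_mat k n" "i < m" "j < n"
  shows "(A * B) $$ (i, j) = (\<Sum>l<k. A $$ (i, l) * B $$ (l, j))"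
  using assms by (auto simp: scalar_prod_def atLeast0LessThan)

text \<open>A one-sided inverse of a square matrix is two-sided, so one of the two defining
  equations suffices.\<close>

lemma unitary_matsI:
  assumes "U \<in> carrier_mat d d" "U * mat_adjoint U = 1\<^sub>m d"
  shows "U \<in> unitary_mats d"
  using assms mat_mult_left_right_inverse[of U d "mat_adjoint U"]
  by (auto simp: unitary_mats_def)

lemma unitary_mats_mult:
  assumes "U \<in> unitary_mats d" "V \<in> unitary_mats d"
  shows "U * V \<in> unitary_mats d"
proof (rule unitary_matsI)
  have [simp]: "U \<in> carrier_mat d d" "V \<in> carrier_mat d d" "mat_adjoint U \<in> carrier_mat d d"
      "mat_adjoint V \<in> carrier_mat d d"
    and U: "U * mat_adjoint U = 1\<^sub>m d" and V: "V * mat_adjoint V = 1\<^sub>m d"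
    using assms by (auto simp: unitary_mats_def)
  show "U * V \<in> carrier_mat d d"
    by (rule mult_carrier_mat[of _ d d]) auto
  have "U * V * mat_adjoint (U * V) = U * (V * mat_adjoint V) * mat_adjoint U"
    by (simp add: mat_adjoint_mult[of _ d d _ d] assoc_mult_mat[of _ d d _ d _ d]
        mult_carrier_mat[of _ d d _ d])
  then show "U * V * mat_adjoint (U * V) = 1\<^sub>m d"
    by (simp add: U V right_mult_one_mat[of _ d d])
qed

lemma unitary_mats_adjoint: "U \<in> unitary_mats d \<Longrightarrow> mat_adjoint U \<in> unitary_mats d"
  by (auto simp: unitary_mats_def)

section \<open>Unitary invariance of the Frobenius norm and uniqueness of the constant\<close>

definition frobenius_norm_sq :: "complex mat \<Rightarrow> real" where
  "frobenius_norm_sq A = (\<Sum>i<dim_row A. \<Sum>j<dim_col A. (cmod (A $$ (i, j)))\<^sup>2)"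

lemma frobenius_norm_sq_adjoint: "frobenius_norm_sq (mat_adjoint A) = frobenius_norm_sq A"
  unfolding frobenius_norm_sq_def by (subst sum.swap) simp

text \<open>The right-hand side is the trace of \<open>mat_adjoint A * A\<close>, a form in which a
  unitary left factor of \<open>A\<close> cancels.\<close>

lemma frobenius_norm_sq_conv_diagonal:
  "complex_of_real (frobenius_norm_sq A) = (\<Sum>j<dim_col A. (mat_adjoint A * A) $$ (j, j))"
  unfolding frobenius_norm_sq_def
  by (subst sum.swap)
     (auto simp: scalar_prod_def complex_norm_square atLeast0LessThan mult.commute
      simp del: of_real_power intro!: sum.cong)

lemma frobenius_norm_sq_unitary_mult:
  assumes "U \<in> unitary_mats m" "A \<in> carrier_mat m n"
  shows "frobenius_norm_sq (U * A) = frobenius_norm_sq A"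
proof -
  have [simp]: "U \<in> carrier_mat m m" "mat_adjoint U \<in> carrier_mat m m" "mat_adjoint A \<in> carrier_mat n m"
    and U: "mat_adjoint U * U = 1\<^sub>m m"
    using assms by (auto simp: unitary_mats_def)
  have "mat_adjoint (U * A) * (U * A) = mat_adjoint A * (mat_adjoint U * (U * A))"
    using assms(2)
    by (simp add: mat_adjoint_mult[of _ m m _ n] mult_carrier_mat[of U m m A n]
        assoc_mult_mat[of "mat_adjoint A" n m "mat_adjoint U" m "U * A" n])
  also have "mat_adjoint U * (U * A) = A"
    using assms(2) U by (simp flip: assoc_mult_mat[of "mat_adjoint U" m m U m A n])
  finally have "complex_of_real (frobenius_norm_sq (U * A)) = complex_of_real (frobenius_norm_sq A)"
    unfolding frobenius_norm_sq_conv_diagonal using assms(2) by simp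
  then show ?thesis
    using of_real_eq_iff by blast
qed

text \<open>The adjoint preserves the norm and turns \<open>U * A * mat_adjoint U\<close> into
  \<open>U * mat_adjoint (U * A)\<close>, so invariance under left multiplication, applied twice,
  suffices.\<close>

lemma frobenius_norm_sq_unitary_conj:
  assumes U: "U \<in> unitary_mats m" and A: "A \<in> carrier_mat m m"
  shows "frobenius_norm_sq (U * A * mat_adjoint U) = frobenius_norm_sq A"
proof -
  have c: "U \<in> carrier_mat m m" using U by (simp add: unitary_mats_def)
  then have UA: "U * A \<in> carrier_mat m m" using A by (rule mult_carrier_mat)
  have "frobenius_norm_sq (U * A * mat_adjoint U) = frobenius_norm_sq (U * mat_adjoint (U * A))"
    using frobenius_norm_sq_adjoint[of "U * A * mat_adjoint U"]
    by (simp add: mat_adjoint_mult[OF UA mat_adjoint_carrier[OF c]])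
  also have "\<dots> = frobenius_norm_sq A"
    using frobenius_norm_sq_unitary_mult[OF U mat_adjoint_carrier[OF UA]]
      frobenius_norm_sq_unitary_mult[OF U A] frobenius_norm_sq_adjoint[of "U * A"]
    by simp
  finally show ?thesis .
qed

lemma uniform_mat_with_frobenius_norm_sq:
  assumes "uniform_mat_with \<kappa> A" "A \<in> carrier_mat m m"
  shows "frobenius_norm_sq A = (real m * \<kappa>)\<^sup>2"
  using assms by (simp add: uniform_mat_with_def frobenius_norm_sq_def power2_eq_square)

text \<open>The Frobenius norm determines only the square of \<open>\<kappa>\<close>; this settles
  the sign.\<close>

lemma uniform_mat_with_nonneg:
  assumes "uniform_mat_with \<kappa> A" "A \<in> carrier_mat m m" "0 < m"
  shows "0 \<le> \<kappa>"
proof -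
  have "cmod (A $$ (0, 0)) = \<kappa>"
    using assms by (auto simp: uniform_mat_with_def)
  then show ?thesis
    by (metis norm_ge_zero)
qed

text \<open>Every unitary conjugate of \<open>A\<close> has the same Frobenius norm, and for a
  uniform one with constant \<open>c\<close> its square is \<open>(m * c)\<^sup>2\<close>. As
  \<open>c\<close> is nonnegative and \<open>m\<close> positive, \<open>c\<close> is
  determined.\<close>

lemma U_apportionment_constant_eqI:
  assumes A: "A \<in> carrier_mat m m" and m: "0 < m" and U: "U \<in> unitary_mats m"
    and unif: "uniform_mat_with \<kappa> (U * A * mat_adjoint U)"
  shows "U_apportionment_constant A = \<kappa>"
  unfolding U_apportionment_constant_def
proof (rule the_equality)
  show "\<exists>U\<in>unitary_mats (dim_row A). uniform_mat_with \<kappa> (U * A * mat_adjoint U)"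
    using A U unif by auto
next
  have carr: "V * A * mat_adjoint V \<in> carrier_mat m m" if "V \<in> unitary_mats m" for V
    using that A by (auto simp: unitary_mats_def)
  have norm: "frobenius_norm_sq A = (real m * c)\<^sup>2" and nonneg: "0 \<le> c"
    if "V \<in> unitary_mats m" "uniform_mat_with c (V * A * mat_adjoint V)" for V c
    using uniform_mat_with_frobenius_norm_sq[OF that(2) carr[OF that(1)]]
      uniform_mat_with_nonneg[OF that(2) carr[OF that(1)] m]
      frobenius_norm_sq_unitary_conj[OF that(1) A] by simp_all
  fix c
  assume "\<exists>V\<in>unitary_mats (dim_row A). uniform_mat_with c (V * A * mat_adjoint V)"
  then obtain V where "V \<in> unitary_mats m" "uniform_mat_with c (V * A * mat_adjoint V)"
    using A by auto
  then have "(real m * c)\<^sup>2 = (real m * \<kappa>)\<^sup>2" "0 \<le> c" "0 \<le> \<kappa>"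
    using norm nonneg U unif by metis+
  then show "c = \<kappa>"
    using m by (simp add: power_mult_distrib)
qed

text \<open>The inner \<open>mat_adjoint U * U\<close> cancels. This later merges the factors of
  \<open>Q * H * mat_adjoint Q\<close> into a single conjugation by \<open>U\<close>.\<close>

lemma unitary_conj_mult:
  assumes U: "U \<in> unitary_mats m" and X: "X \<in> carrier_mat m m" and Y: "Y \<in> carrier_mat m m"
  shows "(U * X * mat_adjoint U) * (U * Y * mat_adjoint U) = U * (X * Y) * mat_adjoint U"
proof -
  have U_carr: "U \<in> carrier_mat m m" "mat_adjoint U \<in> carrier_mat m m"
    and UU: "mat_adjoint U * U = 1\<^sub>m m"
    using U by (auto simp: unitary_mats_def)
  note carr = U_carr X Y mult_carrier_mat[of _ m m _ m]
  note assoc = assoc_mult_mat[of _ m m _ m _ m]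
  have "(U * X * mat_adjoint U) * (U * Y * mat_adjoint U)
      = U * X * ((mat_adjoint U * U) * (Y * mat_adjoint U))"
    by (simp add: assoc carr)
  also have "\<dots> = U * X * (Y * mat_adjoint U)"
    by (simp add: UU carr left_mult_one_mat[of _ m m])
  also have "\<dots> = U * (X * Y) * mat_adjoint U"
    by (simp add: assoc carr)
  finally show ?thesis .
qed

lemma mat_adjoint_unitary_conj:
  fixes U X :: "complex mat"
  assumes "U \<in> carrier_mat m m" "X \<in> carrier_mat m m"
  shows "mat_adjoint (U * X * mat_adjoint U) = U * mat_adjoint X * mat_adjoint U"
proof -
  have U': "mat_adjoint U \<in> carrier_mat m m" and X': "mat_adjoint X \<in> carrier_mat m m"
    using assms by simp_all
  have UX: "U * X \<in> carrier_mat m m"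
    using assms by (rule mult_carrier_mat)
  show ?thesis
    by (simp add: mat_adjoint_mult[OF UX U'] mat_adjoint_mult[OF assms] assoc_mult_mat[OF assms(1) X' U'])
qed


section \<open>Conjugation by the blowup unitary\<close>

lemma perm_mat_carrier [simp]: "perm_mat d p \<in> carrier_mat d d"
  by (simp add: perm_mat_def)

text \<open>Asks only that \<open>q\<close> map the index range into itself: the cyclic shift does
  so, but it is not a \<open>permutes\<close> function, since it moves the numbers from
  \<open>d\<close> on.\<close>

lemma perm_mat_mult:
  assumes "q ` {..<d} \<subseteq> {..<d}"
  shows "perm_mat d p * perm_mat d q = perm_mat d (p \<circ> q)"
proof (rule eq_matI)
  fix i j assume "i < dim_row (perm_mat d (p \<circ> q))" "j < dim_col (perm_mat d (p \<circ> q))"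
  then have ij: "i < d" "j < d" "q j < d"
    using assms by (auto simp: perm_mat_def)
  then have "(perm_mat d p * perm_mat d q) $$ (i, j)
      = (\<Sum>k<d. if k = q j then (if i = p (q j) then 1 else 0) else 0)"
    by (subst index_mult_mat_sum[of _ d d _ d]) (auto simp: perm_mat_def simp del: sum.delta intro!: sum.cong)
  then show "(perm_mat d p * perm_mat d q) $$ (i, j) = perm_mat d (p \<circ> q) $$ (i, j)"
    using ij by (simp add: perm_mat_def)
qed (auto simp: perm_mat_def)

lemma mat_adjoint_perm_mat:
  assumes "p permutes {..<d}"
  shows "mat_adjoint (perm_mat d p) = perm_mat d (inv_into UNIV p)"
  using assms by (intro eq_matI) (auto simp: perm_mat_def permutes_inverses)

lemma perm_mat_unitary:
  assumes "p permutes {..<d}"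
  shows "perm_mat d p \<in> unitary_mats d"
proof (rule unitary_matsI)
  have "perm_mat d p * mat_adjoint (perm_mat d p) = perm_mat d (p \<circ> inv_into UNIV p)"
    using permutes_image[OF permutes_inv[OF assms]]
    by (simp add: mat_adjoint_perm_mat[OF assms] perm_mat_mult)
  also have "\<dots> = 1\<^sub>m d"
    using permutes_inv_o(1)[OF assms] by (auto simp: perm_mat_def)
  finally show "perm_mat d p * mat_adjoint (perm_mat d p) = 1\<^sub>m d" .
qed simp

text \<open>Conjugation moves the entry of \<open>B\<close> at \<open>(a, b)\<close> to
  \<open>(p a, p b)\<close>; for an adjacency matrix this relabels each vertex \<open>a\<close> by
  \<open>p a\<close>.\<close>

lemma perm_mat_conj:
  assumes "p permutes {..<d}" "B \<in> carrier_mat d d"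
  shows "perm_mat d p * B * mat_adjoint (perm_mat d p) = mat d d (\<lambda>(i, j). B $$ (inv_into UNIV p i, inv_into UNIV p j))"
proof (rule eq_matI)
  fix i j assume "i < dim_row (mat d d (\<lambda>(i, j). B $$ (inv_into UNIV p i, inv_into UNIV p j)))"
    "j < dim_col (mat d d (\<lambda>(i, j). B $$ (inv_into UNIV p i, inv_into UNIV p j)))"
  then have ij: "i < d" "j < d" by auto
  have inv: "inv_into UNIV p k < d" if "k < d" for k
    using that permutes_in_image[OF permutes_inv[OF assms(1)], of k] by simp
  have perm: "perm_mat d p $$ (k, l) = (if l = inv_into UNIV p k then 1 else 0)" if "k < d" "l < d" for k l
    using that permutes_inv_eq[OF assms(1), of k l] by (auto simp: perm_mat_def)
  have left: "(perm_mat d p * B) $$ (i, k) = B $$ (inv_into UNIV p i, k)" if "k < d" for k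
  proof -
    have "(perm_mat d p * B) $$ (i, k) = (\<Sum>l<d. if l = inv_into UNIV p i then B $$ (l, k) else 0)"
      using assms ij that perm
      by (subst index_mult_mat_sum[of _ d d _ d]) (auto simp del: sum.delta intro!: sum.cong)
    then show ?thesis
      using inv ij by simp
  qed
  have "(perm_mat d p * B * mat_adjoint (perm_mat d p)) $$ (i, j)
      = (\<Sum>k<d. (perm_mat d p * B) $$ (i, k) * mat_adjoint (perm_mat d p) $$ (k, j))"
    using assms ij by (intro index_mult_mat_sum[of _ d d]) (auto intro: mult_carrier_mat[of _ d d])
  also have "\<dots> = (\<Sum>k<d. if k = inv_into UNIV p j then B $$ (inv_into UNIV p i, k) else 0)"
    using ij left perm carrier_matD[OF perm_mat_carrier[of d p]]
    by (intro sum.cong) (auto simp del: index_mult_mat(1))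
  also have "\<dots> = B $$ (inv_into UNIV p i, inv_into UNIV p j)"
    using inv ij by simp
  finally show "(perm_mat d p * B * mat_adjoint (perm_mat d p)) $$ (i, j)
      = mat d d (\<lambda>(i, j). B $$ (inv_into UNIV p i, inv_into UNIV p j)) $$ (i, j)"
    using ij by simp
qed (use assms in \<open>auto simp: perm_mat_def\<close>)

lemma cyclic_mat_pow:
  "cyclic_mat d ^\<^sub>m k = perm_mat d (\<lambda>i. (i + k) mod d)"
proof (induction k)
  case 0
  show ?case
    by (intro eq_matI) (auto simp: cyclic_mat_def perm_mat_def)
next
  case (Suc k)
  have "(\<lambda>i. (i + 1) mod d) ` {..<d} \<subseteq> {..<d}"
    by auto
  then have "cyclic_mat d ^\<^sub>m Suc k = perm_mat d ((\<lambda>i. (i + k) mod d) \<circ> (\<lambda>i. (i + 1) mod d))"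
    using Suc by (simp add: cyclic_mat_def perm_mat_mult)
  then show ?case
    by (simp add: comp_def mod_simps)
qed

lemma mat_diag_pow: "mat_diag d f ^\<^sub>m k = mat_diag d (\<lambda>i. f i ^ k :: complex)"
proof (induction k)
  case (Suc k)
  then show ?case by (simp add: mult.commute)
qed (simp add: mat_diag_def)

section \<open>Block indices and block-diagonal matrices\<close>

lemma mod_mult_lt_square: "(j :: nat) < d \<Longrightarrow> c < d \<Longrightarrow> c + j * d < d * d"
  using mult_le_mono1[of "Suc j" d d] by simp

text \<open>Division by \<open>d\<close> splits an index below \<open>d * d\<close> into a block
  number \<open>j\<close> and a position \<open>c\<close> inside the block.\<close>

lemma sum_square:
  "sum h {..<d * d :: nat} = (\<Sum>j<d. \<Sum>c<d. h (c + j * d))"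
proof -
  have "(\<Sum>j<d. \<Sum>c<d. h (c + j * d)) = (\<Sum>j<d. sum h {j * d..<j * d + d})"
  proof (rule sum.cong[OF refl])
    fix j
    show "(\<Sum>c<d. h (c + j * d)) = sum h {j * d..<j * d + d}"
      using sum.shift_bounds_nat_ivl[of h 0 "j * d" d] by (simp add: atLeast0LessThan add.commute)
  qed
  then show ?thesis
    using sum.nat_group[of h d d] by simp
qed

lemma one_kronecker_carrier [simp]:
  "M \<in> carrier_mat d d \<Longrightarrow> 1\<^sub>m d \<otimes>\<^sub>m M \<in> carrier_mat (d * d) (d * d)"
  by (auto simp: kronecker_product_def)

lemma index_one_kronecker:
  assumes "M \<in> carrier_mat d d" "x < d * d" "y < d * d"
  shows "(1\<^sub>m d \<otimes>\<^sub>m M) $$ (x, y) = (if x div d = y div d then M $$ (x mod d, y mod d) else 0)"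
  using assms less_mult_imp_div_less[of x d d] less_mult_imp_div_less[of y d d]
  by (auto simp: kronecker_product_def)

lemma one_kronecker_mult:
  assumes "A \<in> carrier_mat d d" "B \<in> carrier_mat d d"
  shows "(1\<^sub>m d \<otimes>\<^sub>m A) * (1\<^sub>m d \<otimes>\<^sub>m B) = 1\<^sub>m d \<otimes>\<^sub>m (A * B)"
proof (rule eq_matI)
  have AB: "A * B \<in> carrier_mat d d" using assms by auto
  fix x y assume "x < dim_row (1\<^sub>m d \<otimes>\<^sub>m (A * B))" "y < dim_col (1\<^sub>m d \<otimes>\<^sub>m (A * B))"
  then have xy: "x < d * d" "y < d * d"
    using one_kronecker_carrier[OF AB] by auto
  then have d: "0 < d" by (cases d) auto
  have xd: "x div d < d" using xy by (simp add: less_mult_imp_div_less)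
  have "((1\<^sub>m d \<otimes>\<^sub>m A) * (1\<^sub>m d \<otimes>\<^sub>m B)) $$ (x, y)
      = (\<Sum>z<d * d. (1\<^sub>m d \<otimes>\<^sub>m A) $$ (x, z) * (1\<^sub>m d \<otimes>\<^sub>m B) $$ (z, y))"
    using assms xy by (intro index_mult_mat_sum) auto
  also have "\<dots> = (\<Sum>z<d * d. if x div d = z div d \<and> z div d = y div d
      then A $$ (x mod d, z mod d) * B $$ (z mod d, y mod d) else 0)"
    using assms xy by (intro sum.cong) (auto simp: index_one_kronecker)
  also have "\<dots> = (\<Sum>j<d. \<Sum>c<d. if x div d = j \<and> j = y div d
      then A $$ (x mod d, c) * B $$ (c, y mod d) else 0)"
    unfolding sum_square using d by (intro sum.cong) auto
  also have "\<dots> = (\<Sum>j<d. if x div d = j then (if x div d = y div d then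
       (\<Sum>c<d. A $$ (x mod d, c) * B $$ (c, y mod d)) else 0) else 0)"
    by (intro sum.cong) auto
  also have "\<dots> = (1\<^sub>m d \<otimes>\<^sub>m (A * B)) $$ (x, y)"
    using xd xy assms d AB by (auto simp: index_one_kronecker scalar_prod_def atLeast0LessThan)
  finally show "((1\<^sub>m d \<otimes>\<^sub>m A) * (1\<^sub>m d \<otimes>\<^sub>m B)) $$ (x, y) = (1\<^sub>m d \<otimes>\<^sub>m (A * B)) $$ (x, y)" .
qed (use assms in \<open>auto simp: kronecker_product_def\<close>)

lemma mat_adjoint_one_kronecker:
  assumes "A \<in> carrier_mat d d"
  shows "mat_adjoint (1\<^sub>m d \<otimes>\<^sub>m A) = 1\<^sub>m d \<otimes>\<^sub>m mat_adjoint A"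
proof (rule eq_matI)
  fix x y assume "x < dim_row (1\<^sub>m d \<otimes>\<^sub>m mat_adjoint A)" "y < dim_col (1\<^sub>m d \<otimes>\<^sub>m mat_adjoint A)"
  then have xy: "x < d * d" "y < d * d"
    using assms by (auto simp: kronecker_product_def)
  then have "0 < d" by (cases d) auto
  then show "mat_adjoint (1\<^sub>m d \<otimes>\<^sub>m A) $$ (x, y) = (1\<^sub>m d \<otimes>\<^sub>m mat_adjoint A) $$ (x, y)"
    using xy assms carrier_matD[OF one_kronecker_carrier[OF assms]] by (auto simp: index_one_kronecker)
qed (use assms in \<open>auto simp: kronecker_product_def\<close>)

lemma one_kronecker_one: "1\<^sub>m d \<otimes>\<^sub>m 1\<^sub>m d = 1\<^sub>m (d * d)"
proof (rule eq_matI)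
  fix x y assume "x < dim_row (1\<^sub>m (d * d) :: complex mat)" "y < dim_col (1\<^sub>m (d * d) :: complex mat)"
  then have xy: "x < d * d" "y < d * d" by auto
  then have "0 < d" by (cases d) auto
  then show "(1\<^sub>m d \<otimes>\<^sub>m 1\<^sub>m d) $$ (x, y) = 1\<^sub>m (d * d) $$ (x, y)"
    using xy by (auto simp: index_one_kronecker) (metis div_mod_decomp)
qed (auto simp: kronecker_product_def)

lemma one_kronecker_unitary:
  assumes "P \<in> unitary_mats d"
  shows "1\<^sub>m d \<otimes>\<^sub>m P \<in> unitary_mats (d * d)"
  using assms
  by (intro unitary_matsI) (auto simp: unitary_mats_def mat_adjoint_one_kronecker one_kronecker_mult one_kronecker_one)

section \<open>Entries of a conjugate by the blowup unitary\<close>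

lemma blowup_unitary_carrier:
  "blowup_unitary \<omega> n \<in> carrier_mat ((2 * n - 1) * (2 * n - 1)) ((2 * n - 1) * (2 * n - 1))"
  by (simp add: blowup_unitary_def block_mat_def Let_def)

text \<open>Column \<open>c\<close> of the block in block row \<open>i\<close> and block column
  \<open>j\<close> has a single nonzero entry: the diagonal factor contributes
  \<open>\<omega> ^ (i * c)\<close> and the shift moves it to row \<open>c + j\<close> modulo
  \<open>d\<close>.\<close>

lemma index_blowup_unitary:
  assumes d: "d = 2 * n - 1" and "x < d * d" "j < d" "c < d"
  shows "blowup_unitary \<omega> n $$ (x, c + j * d)
    = (if x mod d = (c + j) mod d then \<omega> ^ (x div d * c) / complex_of_real (sqrt (real d)) else 0)"
proof -
  have "0 < d" using assms by auto
  moreover have "x div d < d" using assms by (simp add: less_mult_imp_div_less)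
  moreover have "(c + j * d) mod d = c" "(c + j * d) div d = j"
    using assms by auto
  ultimately have "blowup_unitary \<omega> n $$ (x, c + j * d) = 1 / complex_of_real (sqrt (real d)) *
      (cyclic_mat d ^\<^sub>m j * mat_diag d (\<lambda>k. \<omega> ^ k) ^\<^sub>m (x div d)) $$ (x mod d, c)"
    using assms(2-4) mod_mult_lt_square[of j d c]
    unfolding blowup_unitary_def Let_def d[symmetric] cyclic_mat_pow mat_diag_pow
    by (simp add: block_mat_def perm_mat_def mat_diag_def cong: if_cong)
  also have "\<dots> = (if x mod d = (c + j) mod d then \<omega> ^ (x div d * c) / complex_of_real (sqrt (real d)) else 0)"
    using \<open>0 < d\<close> assms
    by (simp add: cyclic_mat_pow mat_diag_pow mat_diag_mult_right[of _ d] perm_mat_def mult.commute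
        flip: power_mult)
  finally show ?thesis .
qed

text \<open>The first condition leaves one shift \<open>j\<close>, congruent to
  \<open>r - a\<close>; for it the second becomes \<open>a + s = b + r\<close> modulo
  \<open>d\<close>.\<close>

lemma sum_indicator_shifts:
  fixes d r s a b :: nat
  assumes "0 < d" "r < d" "s < d" "a < d" "b < d"
  shows "(\<Sum>j<d. if r = (a + j) mod d \<and> s = (b + j) mod d then z else (0 :: complex))
    = (if (a + s) mod d = (b + r) mod d then z else 0)"
proof -
  \<comment> \<open>Adding \<open>d\<close> first keeps the natural subtraction
    \<open>r + d - a\<close> from being truncated.\<close>
  have 1: "r = (a + j) mod d \<longleftrightarrow> j = (r + d - a) mod d" if "j < d" for j
  proof -
    have "r = (a + j) mod d \<longleftrightarrow> r = (if a + j < d then a + j else a + j - d)"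
      using that assms mod_if[of "a + j" d] by auto
    moreover have "j = (r + d - a) mod d \<longleftrightarrow> j = (if r + d - a < d then r + d - a else r - a)"
      using that assms by (auto simp: mod_if)
    ultimately show ?thesis using that assms by (auto split: if_splits)
  qed
  have 2: "s = (b + (r + d - a) mod d) mod d \<longleftrightarrow> (a + s) mod d = (b + r) mod d"
  proof -
    have "(b + (r + d - a) mod d) mod d = (b + (r + d - a)) mod d"
      by (simp add: mod_simps)
    then have "s = (b + (r + d - a) mod d) mod d \<longleftrightarrow> s mod d = (b + (r + d - a)) mod d"
      using assms by simp
    also have "\<dots> \<longleftrightarrow> (a + s) mod d = (a + (b + (r + d - a))) mod d"
      using cong_add_lcancel_nat[of a s "b + (r + d - a)" d] by (simp add: cong_def)
    also have "a + (b + (r + d - a)) = b + r + d"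
      using assms by simp
    finally show ?thesis by simp
  qed
  have "(\<Sum>j<d. if r = (a + j) mod d \<and> s = (b + j) mod d then z else (0 :: complex))
    = (\<Sum>j<d. if j = (r + d - a) mod d then (if s = (b + (r + d - a) mod d) mod d then z else 0) else 0)"
    using 1 by (intro sum.cong) auto
  also have "\<dots> = (if (a + s) mod d = (b + r) mod d then z else 0)"
    unfolding 2 using assms by simp
  finally show ?thesis .
qed

text \<open>In block column \<open>j\<close>, row \<open>x\<close> of the unitary meets only
  \<open>a\<close> with \<open>a + j\<close> congruent to \<open>x\<close>, and row \<open>y\<close>
  only \<open>b\<close> with \<open>b + j\<close> congruent to \<open>y\<close>. Summing over
  \<open>j\<close> leaves a condition on the difference of \<open>a\<close> and
  \<open>b\<close>.\<close>

lemma index_blowup_conj: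
  fixes M :: "complex mat"
  assumes d: "d = 2 * n - 1" and M: "M \<in> carrier_mat d d" and xy: "x < d * d" "y < d * d"
  shows "(blowup_unitary \<omega> n * (1\<^sub>m d \<otimes>\<^sub>m M) * mat_adjoint (blowup_unitary \<omega> n)) $$ (x, y)
    = (\<Sum>a<d. \<Sum>b<d. if (a + y mod d) mod d = (b + x mod d) mod d
        then \<omega> ^ (x div d * a) * cnj (\<omega> ^ (y div d * b)) * M $$ (a, b) else 0) / of_nat d"
    (is "(?U * ?K * mat_adjoint ?U) $$ (x, y) = _")
proof -
  have U [simp]: "?U \<in> carrier_mat (d * d) (d * d)"
    using blowup_unitary_carrier d by simp
  have K [simp]: "?K \<in> carrier_mat (d * d) (d * d)"
    using M by simp
  have UK: "?U * ?K \<in> carrier_mat (d * d) (d * d)"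
    using U K by (rule mult_carrier_mat)
  have d0: "0 < d" using xy by (cases d) auto
  \<comment> \<open>One factor \<open>1 / \<rho>\<close> comes from the unitary and one from its
    adjoint; together they give the final division by \<open>d\<close>.\<close>
  define \<rho> where "\<rho> = complex_of_real (sqrt (real d))"
  have \<rho>: "\<rho> * \<rho> = of_nat d" "cnj \<rho> = \<rho>"
    by (simp_all add: \<rho>_def flip: of_real_mult)
  have K_entry: "?K $$ (c + i * d, b + j * d) = (if i = j then M $$ (c, b) else 0)"
    if "i < d" "j < d" "c < d" "b < d" for i j c b
    using that M d0 mod_mult_lt_square[of i d c] mod_mult_lt_square[of j d b] by (simp add: index_one_kronecker)
  have UK_entry: "(?U * ?K) $$ (x, b + j * d)
      = (\<Sum>a<d. if x mod d = (a + j) mod d then \<omega> ^ (x div d * a) / \<rho> * M $$ (a, b) else 0)"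
    if "j < d" "b < d" for b j
  proof -
    have "(?U * ?K) $$ (x, b + j * d)
        = (\<Sum>i<d. \<Sum>a<d. ?U $$ (x, a + i * d) * ?K $$ (a + i * d, b + j * d))"
      using mod_mult_lt_square[of j d b] that xy
      by (subst index_mult_mat_sum[OF U K]) (simp_all add: sum_square)
    also have "\<dots> = (\<Sum>i<d. if i = j then
        (\<Sum>a<d. if x mod d = (a + j) mod d then \<omega> ^ (x div d * a) / \<rho> * M $$ (a, b) else 0) else 0)"
    proof (rule sum.cong[OF refl])
      fix i assume "i \<in> {..<d}"
      then have i: "i < d" by simp
      show "(\<Sum>a<d. ?U $$ (x, a + i * d) * ?K $$ (a + i * d, b + j * d)) = (if i = j then
        (\<Sum>a<d. if x mod d = (a + j) mod d then \<omega> ^ (x div d * a) / \<rho> * M $$ (a, b) else 0) else 0)"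
      proof (cases "i = j")
        case True
        then show ?thesis
          using i that xy by (auto simp: K_entry index_blowup_unitary[OF d] \<rho>_def intro!: sum.cong)
      next
        case False
        then show ?thesis
          using i that by (simp add: K_entry)
      qed
    qed
    finally show ?thesis
      using that by simp
  qed
  have "(?U * ?K * mat_adjoint ?U) $$ (x, y)
      = (\<Sum>j<d. \<Sum>b<d. (?U * ?K) $$ (x, b + j * d) * mat_adjoint ?U $$ (b + j * d, y))"
    using xy by (subst index_mult_mat_sum[OF UK mat_adjoint_carrier[OF U]]) (simp_all only: sum_square)
  also have "\<dots> = (\<Sum>j<d. \<Sum>b<d. \<Sum>a<d. if x mod d = (a + j) mod d \<and> y mod d = (b + j) mod d
      then \<omega> ^ (x div d * a) * cnj (\<omega> ^ (y div d * b)) * M $$ (a, b) / of_nat d else 0)"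
  proof (intro sum.cong[OF refl])
    fix j b assume "j \<in> {..<d}" "b \<in> {..<d}"
    then have jb: "j < d" "b < d" by auto
    have "mat_adjoint ?U $$ (b + j * d, y)
        = (if y mod d = (b + j) mod d then cnj (\<omega> ^ (y div d * b)) / \<rho> else 0)"
      using jb xy mod_mult_lt_square[OF jb] carrier_matD[OF U]
      by (simp add: index_blowup_unitary[OF d] \<rho>(2)[unfolded \<rho>_def] \<rho>_def)
    then show "(?U * ?K) $$ (x, b + j * d) * mat_adjoint ?U $$ (b + j * d, y)
      = (\<Sum>a<d. if x mod d = (a + j) mod d \<and> y mod d = (b + j) mod d
      then \<omega> ^ (x div d * a) * cnj (\<omega> ^ (y div d * b)) * M $$ (a, b) / of_nat d else 0)"
      unfolding UK_entry[OF jb] sum_distrib_right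
      by (intro sum.cong) (auto simp: \<rho>(1)[symmetric])
  qed
  \<comment> \<open>Three interchanges make the sum over the shift \<open>j\<close> innermost, as
    \<open>sum_indicator_shifts\<close> requires.\<close>
  also have "\<dots> = (\<Sum>j<d. \<Sum>a<d. \<Sum>b<d. if x mod d = (a + j) mod d \<and> y mod d = (b + j) mod d
      then \<omega> ^ (x div d * a) * cnj (\<omega> ^ (y div d * b)) * M $$ (a, b) / of_nat d else 0)"
    by (intro sum.cong[OF refl] sum.swap)
  also have "\<dots> = (\<Sum>a<d. \<Sum>j<d. \<Sum>b<d. if x mod d = (a + j) mod d \<and> y mod d = (b + j) mod d
      then \<omega> ^ (x div d * a) * cnj (\<omega> ^ (y div d * b)) * M $$ (a, b) / of_nat d else 0)"
    by (rule sum.swap)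
  also have "\<dots> = (\<Sum>a<d. \<Sum>b<d. \<Sum>j<d. if x mod d = (a + j) mod d \<and> y mod d = (b + j) mod d
      then \<omega> ^ (x div d * a) * cnj (\<omega> ^ (y div d * b)) * M $$ (a, b) / of_nat d else 0)"
    by (intro sum.cong[OF refl] sum.swap)
  also have "\<dots> = (\<Sum>a<d. \<Sum>b<d. if (a + y mod d) mod d = (b + x mod d) mod d
        then \<omega> ^ (x div d * a) * cnj (\<omega> ^ (y div d * b)) * M $$ (a, b) / of_nat d else 0)"
    using d0 by (intro sum.cong[OF refl] sum_indicator_shifts) auto
  finally show ?thesis
    by (simp add: sum_divide_distrib if_distrib[of "\<lambda>z. z / of_nat d"] cong: if_cong)
qed

section \<open>Orthogonality of root powers and unitarity\<close>

lemma primitive_root_of_unity_norm: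
  assumes "primitive_root_of_unity d \<omega>" "0 < d"
  shows "cmod \<omega> = 1"
  using assms power_eq_1_iff[of \<omega> d] by (auto simp: primitive_root_of_unity_def)

text \<open>A geometric sum whose ratio is a \<open>d\<close>-th root of unity; by primitivity the
  ratio is 1 only for \<open>i = j\<close>.\<close>

lemma sum_powers_primitive_root:
  assumes \<omega>: "primitive_root_of_unity d \<omega>" and ij: "i < d" "j < d"
  shows "(\<Sum>a<d. \<omega> ^ (i * a) * cnj (\<omega> ^ (j * a))) = (if i = j then of_nat d else 0)"
proof -
  have d: "0 < d" using ij by auto
  have norm: "cmod \<omega> = 1"
    using primitive_root_of_unity_norm[OF \<omega> d] .
  then have c: "\<omega> * cnj \<omega> = 1"
    by (simp flip: complex_norm_square)
  define z where "z = \<omega> ^ i * cnj (\<omega> ^ j)"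
  have "\<omega> ^ d = 1"
    using \<omega> by (simp add: primitive_root_of_unity_def)
  moreover from this have "cnj \<omega> ^ d = 1"
    by (simp flip: complex_cnj_power)
  moreover have "z ^ d = (\<omega> ^ d) ^ i * (cnj \<omega> ^ d) ^ j"
    by (simp add: z_def power_mult_distrib mult.commute flip: power_mult)
  ultimately have zd: "z ^ d = 1"
    by simp
  have z1: "z = 1 \<longleftrightarrow> i = j"
  proof -
    have cp: "\<omega> ^ k * cnj (\<omega> ^ k) = 1" for k
      using c by (simp flip: power_mult_distrib)
    \<comment> \<open>Conjugation inverts powers of \<open>\<omega>\<close>, so equality would give
      \<open>\<omega> ^ (l - k) = 1\<close> with \<open>0 < l - k < d\<close>, against
      primitivity.\<close>
    have ne: "\<omega> ^ k * cnj (\<omega> ^ l) \<noteq> 1" if "k < l" "l < d" for k l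
    proof
      assume "\<omega> ^ k * cnj (\<omega> ^ l) = 1"
      then have "\<omega> ^ k * (\<omega> ^ l * cnj (\<omega> ^ l)) = \<omega> ^ l"
        by (metis mult.left_commute mult.right_neutral)
      then have "\<omega> ^ k = \<omega> ^ l" by (simp only: cp mult_1_right)
      also have "\<dots> = \<omega> ^ k * \<omega> ^ (l - k)" using that by (simp flip: power_add)
      finally have "\<omega> ^ (l - k) = 1"
        using norm by auto
      then show False
        using \<omega> that by (auto simp: primitive_root_of_unity_def)
    qed
    show ?thesis
    proof
      assume z: "z = 1"
      \<comment> \<open>Conjugating exchanges \<open>i\<close> and \<open>j\<close>, so
        \<open>ne\<close> excludes both strict orders.\<close>
      then have "cnj z = 1" by simp
      then have "\<omega> ^ j * cnj (\<omega> ^ i) = 1" by (simp add: z_def mult.commute)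
      with z show "i = j"
        using ne[of i j] ne[of j i] ij unfolding z_def by (metis nat_neq_iff)
    qed (use cp in \<open>simp add: z_def\<close>)
  qed
  have "(\<Sum>a<d. \<omega> ^ (i * a) * cnj (\<omega> ^ (j * a))) = (\<Sum>a<d. z ^ a)"
    by (simp add: z_def power_mult_distrib power_mult)
  then show ?thesis
    using z1 zd geometric_sum[of z d] by auto
qed

text \<open>This is \<open>index_blowup_conj\<close> for the identity matrix: only
  \<open>a = b\<close> survives, which forces equal positions in the blocks, and orthogonality of
  the root powers forces equal block numbers.\<close>

lemma blowup_unitary_unitary:
  assumes "primitive_root_of_unity (2 * n - 1) \<omega>"
  shows "blowup_unitary \<omega> n \<in> unitary_mats ((2 * n - 1) * (2 * n - 1))"
proof -
  define d where "d = 2 * n - 1"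
  let ?U = "blowup_unitary \<omega> n"
  have U: "?U \<in> carrier_mat (d * d) (d * d)"
    unfolding d_def by (rule blowup_unitary_carrier)
  have "?U * mat_adjoint ?U = 1\<^sub>m (d * d)"
  proof (rule eq_matI)
    fix x y assume "x < dim_row (1\<^sub>m (d * d) :: complex mat)" "y < dim_col (1\<^sub>m (d * d) :: complex mat)"
    then have xy: "x < d * d" "y < d * d" by auto
    then have d0: "0 < d" by (cases d) auto
    have "(?U * mat_adjoint ?U) $$ (x, y) = (?U * (1\<^sub>m d \<otimes>\<^sub>m 1\<^sub>m d) * mat_adjoint ?U) $$ (x, y)"
      using U by (simp add: one_kronecker_one)
    also have "\<dots> = (\<Sum>a<d. \<Sum>b<d. if (a + y mod d) mod d = (b + x mod d) mod d
        then \<omega> ^ (x div d * a) * cnj (\<omega> ^ (y div d * b)) * 1\<^sub>m d $$ (a, b) else 0) / of_nat d"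
      by (rule index_blowup_conj[OF d_def]) (use xy in auto)
    also have "\<dots> = (\<Sum>a<d. \<Sum>b<d. if b = a then (if y mod d = x mod d
        then \<omega> ^ (x div d * a) * cnj (\<omega> ^ (y div d * a)) else 0) else 0) / of_nat d"
    proof (intro arg_cong[of _ _ "\<lambda>z. z / of_nat d"] sum.cong[OF refl])
      fix a b assume "a \<in> {..<d}" "b \<in> {..<d}"
      moreover have "(a + y mod d) mod d = (a + x mod d) mod d \<longleftrightarrow> y mod d = x mod d"
        using cong_add_lcancel_nat[of a "y mod d" "x mod d" d] by (simp add: cong_def)
      ultimately show "(if (a + y mod d) mod d = (b + x mod d) mod d
        then \<omega> ^ (x div d * a) * cnj (\<omega> ^ (y div d * b)) * 1\<^sub>m d $$ (a, b) else 0)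
        = (if b = a then (if y mod d = x mod d
        then \<omega> ^ (x div d * a) * cnj (\<omega> ^ (y div d * a)) else 0) else 0)"
        by auto
    qed
    also have "\<dots> = (if y mod d = x mod d
        then (\<Sum>a<d. \<omega> ^ (x div d * a) * cnj (\<omega> ^ (y div d * a))) else 0) / of_nat d"
      by simp
    also have "\<dots> = (if y mod d = x mod d \<and> x div d = y div d then 1 else 0)"
      using sum_powers_primitive_root[OF assms[folded d_def], of "x div d" "y div d"] xy d0
      by (auto simp: less_mult_imp_div_less)
    also have "\<dots> = 1\<^sub>m (d * d) $$ (x, y)"
      using xy by auto (metis div_mod_decomp)
    finally show "(?U * mat_adjoint ?U) $$ (x, y) = 1\<^sub>m (d * d) $$ (x, y)" .
  qed (use U in auto)
  then show ?thesis
    using U unitary_matsI unfolding d_def by blast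
qed


section \<open>Loop-graphs and differences of labels\<close>

text \<open>Ordered pairs match the nonzero positions of the adjacency matrix: a nonloop edge occurs
  twice, a loop once.\<close>

definition arcs :: "nat set set \<Rightarrow> (nat \<times> nat) set" where
  "arcs E = {(a, b). {a, b} \<in> E}"

lemma loop_graph_finite:
  assumes "loop_graph n E"
  shows "finite E"
proof (rule finite_subset)
  show "E \<subseteq> Pow {..<n}"
    using assms by (fastforce simp: loop_graph_def)
qed simp

lemma loop_graph_arcs_subset:
  assumes "loop_graph n E"
  shows "arcs E \<subseteq> {..<n} \<times> {..<n}"
  using assms by (fastforce simp: loop_graph_def arcs_def doubleton_eq_iff)

lemma loop_graph_edges_Un:
  assumes "loop_graph n E"
  shows "E = loops E \<union> nonloop_edges E" "loops E \<inter> nonloop_edges E = {}"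
proof -
  have "card e = 1 \<or> card e = 2" if "e \<in> E" for e
  proof -
    from that assms obtain u v where "e = {u, v}"
      by (auto simp: loop_graph_def)
    then show ?thesis
      by (cases "u = v") auto
  qed
  then show "E = loops E \<union> nonloop_edges E" "loops E \<inter> nonloop_edges E = {}"
    by (auto simp: loops_def nonloop_edges_def)
qed

lemma loop_graph_card_edges:
  assumes "loop_graph n E"
  shows "card E = card (loops E) + card (nonloop_edges E)"
  using loop_graph_edges_Un[OF assms] loop_graph_finite[OF assms]
  by (metis card_Un_disjoint finite_Un)

text \<open>Counts the fibres of the map from arcs to edges. For one loop and \<open>n - 1\<close>
  nonloop edges the total is \<open>2 * n - 1\<close>, the number of residues to be covered.\<close>

lemma loop_graph_card_arcs:
  assumes "loop_graph n E"
  shows "card (arcs E) = card (loops E) + 2 * card (nonloop_edges E)"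
proof -
  let ?F = "\<lambda>e. {(a, b). {a, b} = e} :: (nat \<times> nat) set"
  have fin: "finite E" "finite (loops E)" "finite (nonloop_edges E)"
    using loop_graph_finite[OF assms] by (auto simp: loops_def nonloop_edges_def)
  have loop: "card (?F e) = 1" if "card e = 1" for e
  proof -
    from that obtain u where "e = {u}"
      by (auto simp: card_1_singleton_iff)
    then have "?F e = {(u, u)}" by auto
    then show ?thesis by simp
  qed
  have nonloop: "card (?F e) = 2" if "card e = 2" for e
  proof -
    from that obtain u v where "e = {u, v}" "u \<noteq> v"
      by (auto simp: card_2_iff)
    then have "?F e = {(u, v), (v, u)}" by (auto simp: doubleton_eq_iff)
    then show ?thesis using \<open>u \<noteq> v\<close> by simp
  qed
  have E: "card e = 1 \<or> card e = 2" if "e \<in> E" for e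
    using that loop_graph_edges_Un(1)[OF assms] by (auto simp: loops_def nonloop_edges_def)
  have "arcs E = (\<Union>e\<in>E. ?F e)"
    by (auto simp: arcs_def)
  also have "card \<dots> = (\<Sum>e\<in>E. card (?F e))"
  proof (rule card_UN_disjoint)
    \<comment> \<open>Infinite sets have \<open>card\<close> 0, so cardinality 1 or 2 already
      implies finiteness.\<close>
    show "\<forall>e\<in>E. finite (?F e)"
      using E loop nonloop by (metis card.infinite zero_neq_numeral zero_neq_one)
  qed (use fin in auto)
  also have "\<dots> = (\<Sum>e\<in>loops E. card (?F e)) + (\<Sum>e\<in>nonloop_edges E. card (?F e))"
    using loop_graph_edges_Un[OF assms] fin by (metis (no_types, lifting) sum.union_disjoint)
  also have "\<dots> = card (loops E) + 2 * card (nonloop_edges E)"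
    using loop nonloop by (simp add: loops_def nonloop_edges_def)
  finally show ?thesis .
qed

section \<open>Arc differences and uniformity\<close>

definition arc_differences :: "nat \<Rightarrow> (nat \<Rightarrow> nat) \<Rightarrow> nat set set \<Rightarrow> int set" where
  "arc_differences d p E = (\<lambda>(a, b). (int (p a) - int (p b)) mod int d) ` arcs E"

text \<open>Translates the subtraction-free condition on natural indices into one on integer
  differences.\<close>

lemma mod_add_eq_iff_diff:
  fixes a b r s d :: nat
  shows "(a + s) mod d = (b + r) mod d \<longleftrightarrow> (int a - int b) mod int d = (int r - int s) mod int d"
proof -
  have "(a + s) mod d = (b + r) mod d \<longleftrightarrow> int (a + s) mod int d = int (b + r) mod int d"
    by (metis of_nat_eq_iff of_nat_mod)
  then show ?thesis
    by (simp add: mod_eq_dvd_iff algebra_simps)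
qed

text \<open>The zero block adds \<open>n - 1\<close> isolated vertices, and no edge meets an index
  from \<open>n\<close> on, so the edge test stays correct there.\<close>

lemma index_diag_block_adjacency:
  assumes "loop_graph n E" "a < 2 * n - 1" "b < 2 * n - 1"
  shows "diag_block_mat [adjacency_mat n E, 0\<^sub>m (n - 1) (n - 1)] $$ (a, b) = (if {a, b} \<in> E then 1 else 0)"
  using assms loop_graph_arcs_subset[OF assms(1)]
  by (auto simp: adjacency_mat_def arcs_def Let_def)

lemma diag_block_adjacency_carrier:
  assumes "0 < n"
  shows "diag_block_mat [adjacency_mat n E, 0\<^sub>m (n - 1) (n - 1)] \<in> carrier_mat (2 * n - 1) (2 * n - 1)"
  using assms by (auto simp: adjacency_mat_def Let_def)

lemma index_blowup_conj_adjacency: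
  assumes E: "loop_graph n E" and n: "0 < n" and d: "d = 2 * n - 1" and p: "p permutes {..<d}"
    and B: "B = diag_block_mat [adjacency_mat n E, 0\<^sub>m (n - 1) (n - 1)]"
    and xy: "x < d * d" "y < d * d"
  shows "(blowup_unitary \<omega> n * (1\<^sub>m d \<otimes>\<^sub>m (perm_mat d p * B * mat_adjoint (perm_mat d p)))
      * mat_adjoint (blowup_unitary \<omega> n)) $$ (x, y)
    = (\<Sum>(a, b)\<in>{(a, b) \<in> arcs E. (int (p a) - int (p b)) mod int d = (int (x mod d) - int (y mod d)) mod int d}.
         \<omega> ^ (x div d * p a) * cnj (\<omega> ^ (y div d * p b))) / of_nat d"
proof -
  have B_carr: "B \<in> carrier_mat d d"
    unfolding B d using diag_block_adjacency_carrier[OF n] .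
  define M where "M = perm_mat d p * B * mat_adjoint (perm_mat d p)"
  have M: "M = mat d d (\<lambda>(i, j). B $$ (inv_into UNIV p i, inv_into UNIV p j))"
    unfolding M_def by (rule perm_mat_conj[OF p B_carr])
  then have M_carr: "M \<in> carrier_mat d d" by simp
  define h where "h a b = \<omega> ^ (x div d * a) * cnj (\<omega> ^ (y div d * b))" for a b
  let ?C = "\<lambda>a b. (a + y mod d) mod d = (b + x mod d) mod d"
  have p_lt: "p a < d" if "a < d" for a
    using that permutes_in_image[OF p, of a] by simp
  have M_entry: "M $$ (p a, p b) = (if (a, b) \<in> arcs E then 1 else 0)" if "a < d" "b < d" for a b
    using that p_lt index_diag_block_adjacency[OF E, of a b]
    by (simp add: M permutes_inverses[OF p] arcs_def B d)
  have arcs: "arcs E \<subseteq> {..<d} \<times> {..<d}"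
    using loop_graph_arcs_subset[OF E] n d by fastforce
  \<comment> \<open>Reindexing both sums by \<open>p\<close> turns the entries of \<open>M\<close>
    into the indicator of \<open>arcs E\<close>.\<close>
  have "(\<Sum>a<d. \<Sum>b<d. if ?C a b then h a b * M $$ (a, b) else 0)
      = (\<Sum>a<d. \<Sum>b<d. if ?C (p a) b then h (p a) b * M $$ (p a, b) else 0)"
    by (subst sum.permute[OF p]) (simp add: comp_def)
  also have "\<dots> = (\<Sum>a<d. \<Sum>b<d. if ?C (p a) (p b) then h (p a) (p b) * M $$ (p a, p b) else 0)"
    by (rule sum.cong[OF refl], subst sum.permute[OF p]) (simp add: comp_def)
  also have "\<dots> = (\<Sum>a<d. \<Sum>b<d. if (a, b) \<in> arcs E \<and> ?C (p a) (p b) then h (p a) (p b) else 0)"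
    using M_entry by (intro sum.cong[OF refl]) simp
  also have "\<dots> = (\<Sum>z\<in>{..<d} \<times> {..<d}. if z \<in> arcs E \<and> ?C (p (fst z)) (p (snd z))
      then h (p (fst z)) (p (snd z)) else 0)"
    by (simp add: sum.cartesian_product case_prod_beta)
  also have "\<dots> = (\<Sum>z\<in>{z \<in> {..<d} \<times> {..<d}. z \<in> arcs E \<and> ?C (p (fst z)) (p (snd z))}.
      h (p (fst z)) (p (snd z)))"
    by (rule sum.inter_filter[symmetric]) simp
  also have "{z \<in> {..<d} \<times> {..<d}. z \<in> arcs E \<and> ?C (p (fst z)) (p (snd z))}
     = {(a, b) \<in> arcs E. (int (p a) - int (p b)) mod int d = (int (x mod d) - int (y mod d)) mod int d}"
    using arcs unfolding mod_add_eq_iff_diff by auto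
  finally show ?thesis
    unfolding M_def[symmetric] index_blowup_conj[OF d M_carr xy] by (simp only: h_def case_prod_unfold)
qed

text \<open>Uniformity with any constant forces covering, and covering forces the constant
  \<open>1 / d\<close>. The second equivalence later yields the apportionment constant.\<close>

lemma blowup_conj_uniform_iff:
  fixes p :: "nat \<Rightarrow> nat"
  assumes E: "loop_graph n E" and n: "0 < n" and d: "d = 2 * n - 1" and p: "p permutes {..<d}"
    and card: "card (arcs E) = d" and \<omega>: "primitive_root_of_unity d \<omega>"
  defines "X \<equiv> blowup_unitary \<omega> n * (1\<^sub>m d \<otimes>\<^sub>m
      (perm_mat d p * diag_block_mat [adjacency_mat n E, 0\<^sub>m (n - 1) (n - 1)] * mat_adjoint (perm_mat d p)))
      * mat_adjoint (blowup_unitary \<omega> n)"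
  shows "uniform_mat X \<longleftrightarrow> arc_differences d p E = {0..<int d}"
    and "uniform_mat X \<longleftrightarrow> uniform_mat_with (1 / real d) X"
proof -
  let ?\<delta> = "\<lambda>(a, b). (int (p a) - int (p b)) mod int d"
  let ?F = "\<lambda>t. {(a, b) \<in> arcs E. (int (p a) - int (p b)) mod int d = t}"
  have d0: "0 < d" using n d by simp
  have fin: "finite (arcs E)"
    using d0 card by (metis card.infinite less_irrefl)
  have entry: "X $$ (x, y) = (\<Sum>(a, b)\<in>?F ((int (x mod d) - int (y mod d)) mod int d).
      \<omega> ^ (x div d * p a) * cnj (\<omega> ^ (y div d * p b))) / of_nat d" if "x < d * d" "y < d * d" for x y
    unfolding X_def by (rule index_blowup_conj_adjacency[OF E n d p refl that])
  have U: "blowup_unitary \<omega> n \<in> carrier_mat (d * d) (d * d)"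
    unfolding d by (rule blowup_unitary_carrier)
  have dim: "dim_row X = d * d" "dim_col X = d * d"
    using carrier_matD[OF U] by (simp_all add: X_def)
  have cover: "arc_differences d p E = {0..<int d}" if unif: "uniform_mat X"
  proof -
    obtain c where c: "cmod (X $$ (x, y)) = c" if "x < d * d" "y < d * d" for x y
      using unif dim by (auto simp: uniform_mat_def uniform_mat_with_def)
    have count: "real (card (?F t)) = c * real d" if "t \<in> {0..<int d}" for t
    proof -
      have t: "nat t < d" "int (nat t) = t" "t mod int d = t"
        using that by auto
      moreover have "d \<le> d * d"
        by simp
      ultimately have t': "nat t < d * d"
        by linarith
      \<comment> \<open>Row \<open>nat t\<close> and column 0 lie in the first block, so all
        exponents vanish and the sum counts its index set.\<close>
      have "X $$ (nat t, 0) = of_nat (card (?F t)) / of_nat d"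
        using that t t' d0 entry[of "nat t" 0] by (simp add: case_prod_beta)
      then have "c = real (card (?F t)) / real d"
        using c[of "nat t" 0] t t' d0 by (simp add: norm_divide)
      then show ?thesis
        using d0 by simp
    qed
    \<comment> \<open>One arc makes one count positive; all counts equal \<open>c * d\<close>, so
      every residue is attained.\<close>
    have "arcs E \<noteq> {}"
      using card d0 by auto
    then obtain z where z: "z \<in> arcs E"
      by blast
    have z_range: "?\<delta> z \<in> {0..<int d}"
      using d0 by (auto simp: case_prod_beta)
    have "z \<in> ?F (?\<delta> z)"
      using z by (auto simp: case_prod_beta)
    moreover have "finite (?F (?\<delta> z))"
      using fin by (rule finite_subset[rotated]) auto
    ultimately have "0 < card (?F (?\<delta> z))"
      unfolding card_gt_0_iff by blast
    then have pos: "0 < c * real d"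
      unfolding count[OF z_range, symmetric] of_nat_0_less_iff .
    have "t \<in> arc_differences d p E" if "t \<in> {0..<int d}" for t
    proof -
      have "?F t \<noteq> {}"
        using count[OF that] pos by (intro notI) auto
      then show ?thesis
        unfolding arc_differences_def by force
    qed
    then show ?thesis
      using d0 by (auto simp: arc_differences_def)
  qed
  have unif: "uniform_mat_with (1 / real d) X" if cov: "arc_differences d p E = {0..<int d}"
  proof -
    \<comment> \<open>A map from \<open>d\<close> arcs onto \<open>d\<close> residues is
      injective.\<close>
    have inj: "inj_on ?\<delta> (arcs E)"
      using cov card fin by (intro eq_card_imp_inj_on) (auto simp: arc_differences_def)
    have "cmod (X $$ (x, y)) = 1 / real d" if xy: "x < d * d" "y < d * d" for x y
    proof -
      let ?t = "(int (x mod d) - int (y mod d)) mod int d"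
      have "?t \<in> ?\<delta> ` arcs E"
        using d0 cov unfolding arc_differences_def by simp
      then obtain a b where ab: "(a, b) \<in> arcs E" "?\<delta> (a, b) = ?t"
        by force
      have "?F ?t = {(a, b)}"
      proof (intro equalityI subsetI)
        fix z assume "z \<in> ?F ?t"
        then have "z \<in> arcs E" "?\<delta> z = ?\<delta> (a, b)"
          using ab(2) by auto
        then show "z \<in> {(a, b)}"
          using inj_onD[OF inj] ab(1) by blast
      qed (use ab in auto)
      then have "X $$ (x, y) = \<omega> ^ (x div d * p a) * cnj (\<omega> ^ (y div d * p b)) / of_nat d"
        using entry[OF xy] by simp
      then show ?thesis
        using primitive_root_of_unity_norm[OF \<omega> d0]
        by (simp add: norm_mult norm_divide norm_power)
    qed
    then show ?thesis
      using dim by (simp add: uniform_mat_with_def)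
  qed
  show "uniform_mat X \<longleftrightarrow> arc_differences d p E = {0..<int d}"
    "uniform_mat X \<longleftrightarrow> uniform_mat_with (1 / real d) X"
    using cover unif uniform_mat_def by blast+
qed

section \<open>Labelings as restrictions of permutations\<close>

lemma inj_on_extend_permutes:
  assumes fin: "finite S" and "A \<subseteq> S" "inj_on g A" "g ` A \<subseteq> S"
  obtains p where "p permutes S" "\<And>a. a \<in> A \<Longrightarrow> p a = g a"
proof -
  have finA: "finite A" using assms finite_subset by blast
  have "card (S - A) = card (S - g ` A)"
    using assms finA by (simp add: card_Diff_subset card_image)
  then obtain h where h: "bij_betw h (S - A) (S - g ` A)"
    using fin finite_same_card_bij by (metis finite_Diff)
  define p where "p x = (if x \<in> A then g x else if x \<in> S then h x else x)" for x
  have "bij_betw p (A \<union> (S - A)) (g ` A \<union> (S - g ` A))"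
  proof (rule bij_betw_combine)
    show "bij_betw p A (g ` A)"
      using inj_on_imp_bij_betw[OF assms(3)] by (rule bij_betw_cong[THEN iffD1, rotated]) (simp add: p_def)
    show "bij_betw p (S - A) (S - g ` A)"
      using h by (rule bij_betw_cong[THEN iffD1, rotated]) (simp add: p_def)
  qed auto
  moreover have "A \<union> (S - A) = S" "g ` A \<union> (S - g ` A) = S"
    using assms by auto
  ultimately have "p permutes S"
    using \<open>A \<subseteq> S\<close> by (intro bij_imp_permutes) (auto simp: p_def)
  then show thesis
    using that by (simp add: p_def)
qed

text \<open>\<open>x mod d\<close> is \<open>x\<close> or \<open>x + d\<close>; in the second case
  the two arguments of \<open>min\<close> are merely exchanged.\<close>

lemma mod_eq_cyclic_distance:
  fixes x d :: int
  assumes "\<bar>x\<bar> < d"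
  shows "min \<bar>x\<bar> (d - \<bar>x\<bar>) = min (x mod d) (d - x mod d)"
proof (cases "x \<ge> 0")
  case True
  then show ?thesis using assms by simp
next
  case False
  then have "x mod d = x + d"
    using assms mod_add_self2[of x d] mod_pos_pos_trivial[of "x + d" d] by simp
  then show ?thesis using False by (simp add: min.commute)
qed

lemma setcompr_pair_eq_image: "{F u v | u v. P u v} = (\<lambda>(u, v). F u v) ` {(u, v). P u v}"
  by auto

text \<open>The map from \<open>t\<close> to \<open>min t (d - t)\<close> sends the residues onto
  \<open>{0..<n}\<close> and identifies exactly \<open>t\<close> with \<open>- t\<close> modulo
  \<open>d\<close>. Arc differences are closed under negation, so they cover all residues iff their
  cyclic distances cover \<open>{0..<n}\<close>.\<close>

lemma rho_labeling_iff_permutes: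
  assumes E: "loop_graph n E" and n: "0 < n" and card: "card E = n" and d: "d = 2 * n - 1"
  shows "(\<exists>f. rho_labeling n E f) \<longleftrightarrow> (\<exists>p. p permutes {..<d} \<and> arc_differences d p E = {0..<int d})"
proof -
  have arcs: "a < n" "b < n" if "{a, b} \<in> E" for a b
    using that loop_graph_arcs_subset[OF E] by (auto simp: arcs_def)
  have d': "2 * int n - 1 = int d"
    using n d by simp
  let ?L = "\<lambda>f. {min \<bar>f u - f v\<bar> (int d - \<bar>f u - f v\<bar>) | u v. {u, v} \<in> E}"
  have L_image: "?L f = (\<lambda>(u, v). min \<bar>f u - f v\<bar> (int d - \<bar>f u - f v\<bar>)) ` arcs E" for f
    unfolding arcs_def by (rule setcompr_pair_eq_image)
  have rho: "rho_labeling n E f \<longleftrightarrow>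
      inj_on f {..<n} \<and> f ` {..<n} \<subseteq> {0..<int d} \<and> ?L f = {0..<int n}" for f
  proof -
    have "{0..2 * int n - 2} = {0..<int d}" "{0..int n - 1} = {0..<int n}"
      using d' by auto
    then show ?thesis
      unfolding rho_labeling_def Let_def card d' by (simp only:)
  qed
  \<comment> \<open>Phrased for any map with vertex labels below \<open>d\<close>, so that it serves
    both directions.\<close>
  have key: "?L (\<lambda>u. int (p u)) = {0..<int n} \<longleftrightarrow> arc_differences d p E = {0..<int d}"
    if p: "\<And>u. u < n \<Longrightarrow> p u < d" for p
  proof -
    let ?D = "arc_differences d p E"
    have L: "?L (\<lambda>u. int (p u)) = (\<lambda>t. min t (int d - t)) ` ?D"
    proof -
      have "min \<bar>int (p u) - int (p v)\<bar> (int d - \<bar>int (p u) - int (p v)\<bar>)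
          = min ((int (p u) - int (p v)) mod int d) (int d - (int (p u) - int (p v)) mod int d)"
        if "{u, v} \<in> E" for u v
        using p[OF arcs(1)[OF that]] p[OF arcs(2)[OF that]] by (intro mod_eq_cyclic_distance) auto
      then show ?thesis
        unfolding L_image arc_differences_def image_image
        by (intro image_cong) (auto simp: arcs_def)
    qed
    have D: "?D \<subseteq> {0..<int d}"
      using n d by (auto simp: arc_differences_def)
    \<comment> \<open>Reversing an arc negates its difference.\<close>
    have sym: "(- t) mod int d \<in> ?D" if "t \<in> ?D" for t
    proof -
      from that obtain a b where ab: "{a, b} \<in> E" "t = (int (p a) - int (p b)) mod int d"
        by (auto simp: arc_differences_def arcs_def)
      then have "(- t) mod int d = (int (p b) - int (p a)) mod int d" "(b, a) \<in> arcs E"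
        by (simp_all add: mod_minus_eq arcs_def insert_commute)
      then show ?thesis
        unfolding arc_differences_def by (intro image_eqI[of _ _ "(b, a)"]) auto
    qed
    show ?thesis
    proof
      assume L': "?L (\<lambda>u. int (p u)) = {0..<int n}"
      have "t \<in> ?D" if t: "t \<in> {0..<int d}" for t
      proof -
        have "min t (int d - t) \<in> {0..<int n}"
          using t d' by auto
        then obtain s where s: "s \<in> ?D" "min t (int d - t) = min s (int d - s)"
          using L L' by (metis (no_types, lifting) imageE)
        then consider "s = t" | "s = int d - t"
          by linarith
        then show ?thesis
        proof cases
          case 2
          then have "(- s) mod int d = t"
            using t by (simp add: mod_pos_pos_trivial)
          then show ?thesis using sym[OF s(1)] by simp
        qed (use s in simp)
      qed
      then show "?D = {0..<int d}"
        using D by auto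
    next
      assume D': "?D = {0..<int d}"
      have "(\<lambda>t. min t (int d - t)) ` {0..<int d} = {0..<int n}"
      proof (intro equalityI subsetI)
        fix l assume "l \<in> {0..<int n}"
        then have "l = min l (int d - l)" "l \<in> {0..<int d}"
          using d' by auto
        then show "l \<in> (\<lambda>t. min t (int d - t)) ` {0..<int d}"
          by blast
      qed (use d' in auto)
      then show "?L (\<lambda>u. int (p u)) = {0..<int n}"
        unfolding L D' .
    qed
  qed
  show ?thesis
  proof
    assume "\<exists>f. rho_labeling n E f"
    then obtain f where f: "inj_on f {..<n}" "f ` {..<n} \<subseteq> {0..<int d}" "?L f = {0..<int n}"
      using rho by auto
    have inj: "inj_on (nat \<circ> f) {..<n}"
    proof (rule inj_onI)
      fix u v assume uv: "u \<in> {..<n}" "v \<in> {..<n}" "(nat \<circ> f) u = (nat \<circ> f) v"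
      then have "0 \<le> f u" "0 \<le> f v"
        using f(2) by auto
      then show "u = v"
        using uv inj_onD[OF f(1)] by simp
    qed
    have "0 \<le> f u \<and> f u < int d" if "u < n" for u
      using f(2) that by fastforce
    then have "(nat \<circ> f) ` {..<n} \<subseteq> {..<d}"
      by (auto simp: nat_less_iff)
    moreover have "{..<n} \<subseteq> {..<d}"
      using n d by auto
    ultimately obtain p where p: "p permutes {..<d}" "\<And>u. u \<in> {..<n} \<Longrightarrow> p u = (nat \<circ> f) u"
      using inj_on_extend_permutes[OF finite_lessThan _ inj] by metis
    then have pf: "int (p u) = f u" if "u < n" for u
      using that f(2) by fastforce
    have "?L (\<lambda>u. int (p u)) = ?L f"
      unfolding L_image using arcs pf by (intro image_cong) (auto simp: arcs_def)
    moreover have "p u < d" if "u < n" for u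
      using that permutes_in_image[OF p(1), of u] n d by simp
    ultimately show "\<exists>p. p permutes {..<d} \<and> arc_differences d p E = {0..<int d}"
      using key[of p] p(1) f(3) by auto
  next
    assume "\<exists>p. p permutes {..<d} \<and> arc_differences d p E = {0..<int d}"
    then obtain p where p: "p permutes {..<d}" "arc_differences d p E = {0..<int d}"
      by auto
    have lt: "p u < d" if "u < n" for u
      using that permutes_in_image[OF p(1), of u] n d by simp
    have "inj_on (\<lambda>u. int (p u)) {..<n}"
      using permutes_inj[OF p(1)] by (auto simp: inj_on_def)
    then show "\<exists>f. rho_labeling n E f"
      using rho[of "\<lambda>u. int (p u)"] key[OF lt] p(2) lt by (intro exI[of _ "\<lambda>u. int (p u)"]) auto
  qed
qed

theorem theorem5p2:
  fixes n :: nat and E :: "nat set set" and \<omega> :: complex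
  assumes "loop_graph n E"
    and "card (nonloop_edges E) = n - 1"
    and "card (loops E) = 1"
    and "primitive_root_of_unity (2 * n - 1) \<omega>"
  shows "((\<exists>f. rho_labeling n E f) \<longleftrightarrow>
            apportionable (blowup_group \<omega> n) (cyclic_blowup_mat \<omega> n E))
       \<and> (apportionable (blowup_group \<omega> n) (cyclic_blowup_mat \<omega> n E) \<longrightarrow>
            U_apportionment_constant (cyclic_blowup_mat \<omega> n E) = 1 / (2 * real n - 1))"
proof -
  define d where "d = 2 * n - 1"
  define U where "U = blowup_unitary \<omega> n"
  define B where "B = diag_block_mat [adjacency_mat n E, 0\<^sub>m (n - 1) (n - 1)]"
  define H where "H = cyclic_blowup_mat \<omega> n E"
  define Q where "Q p = U * (1\<^sub>m d \<otimes>\<^sub>m perm_mat d p) * mat_adjoint U" for p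
  define X where "X p = U * (1\<^sub>m d \<otimes>\<^sub>m (perm_mat d p * B * mat_adjoint (perm_mat d p))) * mat_adjoint U" for p
  \<comment> \<open>The loop supplies a vertex, so \<open>n\<close> is positive and
    \<open>2 * n - 1\<close> is not truncated.\<close>
  have "loops E \<noteq> {}"
    using assms(3) by auto
  then have n: "0 < n"
    using assms(1) by (auto simp: loops_def loop_graph_def)
  have card_arcs: "card (arcs E) = d" and card_E: "card E = n"
    using loop_graph_card_arcs[OF assms(1)] loop_graph_card_edges[OF assms(1)] assms(2,3) n
    by (simp_all add: d_def)
  have d0: "0 < d * d"
    using n by (simp add: d_def)
  have B: "B \<in> carrier_mat d d"
    unfolding B_def d_def using diag_block_adjacency_carrier[OF n] .
  have U: "U \<in> unitary_mats (d * d)"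
    unfolding U_def d_def by (rule blowup_unitary_unitary[OF assms(4)])
  then have U_carr: "U \<in> carrier_mat (d * d) (d * d)"
    by (simp add: unitary_mats_def)
  have H: "H = U * (1\<^sub>m d \<otimes>\<^sub>m B) * mat_adjoint U"
    by (simp add: H_def cyclic_blowup_mat_def U_def d_def B_def)
  have H_carr: "H \<in> carrier_mat (d * d) (d * d)"
    unfolding H using U_carr B by auto
  have Q: "Q p \<in> unitary_mats (d * d)" if "p permutes {..<d}" for p
    unfolding Q_def
    using U one_kronecker_unitary[OF perm_mat_unitary[OF that]] by (intro unitary_mats_mult unitary_mats_adjoint)
  \<comment> \<open>All three factors are conjugates by the same \<open>U\<close>, so the product
    takes place inside the blocks.\<close>
  have QHQ: "Q p * H * mat_adjoint (Q p) = X p" for p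
  proof -
    let ?P = "perm_mat d p"
    have carr: "?P * B \<in> carrier_mat d d" "mat_adjoint ?P \<in> carrier_mat d d"
      using B by (auto intro: mult_carrier_mat[of _ d d])
    have "Q p * H = U * (1\<^sub>m d \<otimes>\<^sub>m (?P * B)) * mat_adjoint U"
      unfolding Q_def H using B by (simp add: unitary_conj_mult[OF U] one_kronecker_mult)
    moreover have "mat_adjoint (Q p) = U * (1\<^sub>m d \<otimes>\<^sub>m mat_adjoint ?P) * mat_adjoint U"
      unfolding Q_def by (simp add: mat_adjoint_unitary_conj[OF U_carr] mat_adjoint_one_kronecker)
    ultimately show ?thesis
      unfolding X_def using carr by (simp add: unitary_conj_mult[OF U] one_kronecker_mult)
  qed
  have uniform: "uniform_mat (X p) \<longleftrightarrow> arc_differences d p E = {0..<int d}"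
    "uniform_mat (X p) \<longleftrightarrow> uniform_mat_with (1 / real d) (X p)" if "p permutes {..<d}" for p
    unfolding X_def U_def B_def
    using blowup_conj_uniform_iff[OF assms(1) n d_def that card_arcs assms(4)[folded d_def]] by blast+
  have apportionable: "apportionable (blowup_group \<omega> n) H
      \<longleftrightarrow> (\<exists>p. p permutes {..<d} \<and> uniform_mat (X p))"
  proof -
    have "blowup_group \<omega> n = {Q p | p. p permutes {..<d}}"
      unfolding blowup_group_def permutation_mats_def Q_def U_def d_def by blast
    then show ?thesis
      unfolding apportionable_def by (auto simp: QHQ)
  qed
  have "U_apportionment_constant H = 1 / (2 * real n - 1)" if H_app: "apportionable (blowup_group \<omega> n) H"
  proof -
    obtain p where p: "p permutes {..<d}" "uniform_mat (X p)"
      using H_app apportionable by auto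
    \<comment> \<open>\<open>Q p\<close> is itself unitary, hence a valid witness for the constant
      over all unitary matrices.\<close>
    then have "uniform_mat_with (1 / real d) (Q p * H * mat_adjoint (Q p))"
      using uniform(2) QHQ by simp
    then have "U_apportionment_constant H = 1 / real d"
      using U_apportionment_constant_eqI[OF H_carr d0 Q[OF p(1)]] by simp
    then show ?thesis
      using n by (simp add: d_def)
  qed
  moreover have "(\<exists>f. rho_labeling n E f) \<longleftrightarrow> apportionable (blowup_group \<omega> n) H"
    unfolding apportionable rho_labeling_iff_permutes[OF assms(1) n card_E d_def] using uniform(1) by blast
  ultimately show ?thesis
    unfolding H_def by blast
qed

end
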